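(* Let $G,H$ be locally compact Polish groups and let $P:G\to H$ be a Haar measurable Leibman polynomial. Then $P$ is continuous.
   Context: Groups are written multiplicatively and are not assumed commutative; $1_H$ denotes the identity element of $H$. For groups $G,H$, an element $g\in G$ and a function $f:G\to H$, the difference operator $\Delta_g$ is defined by $\Delta_g f(x)=f(gx)f(x)^{-1}$ for $x\in G$, so $\Delta_g f:G\to H$. For an integer $d\ge 0$, a function $P:G\to H$ is a Leibman polynomial of degree at most $d$ if $$\Delta_{g_d}\cdots\Delta_{g_0}P(x)=1_H\quad\text{for all } x,g_0,\ldots,g_d\in G,$$ where $\Delta_{g_0}$ is applied first. A Leibman polynomial is a function that is a Leibman polynomial of degree at most $d$ for some integer $d\ge 0$. A function $G\to H$ is Haar measurable if the preimage of every open set is a Haar measurable subset of $G$, i.e. measurable with respect to the completion of Haar measure on the Borel sets of $G$. *)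

theory Defs
  imports "HOL-Analysis.Analysis"
begin

text \<open>
  Groups are types of class \<^class>\<open>topological_group_add\<close>. Addition is not assumed commutative
  there, so this is an arbitrary topological group written additively: \<open>g + x\<close> is the product
  \<open>gx\<close>, \<open>0\<close> is the identity, and \<open>a - b = a + (- b)\<close> is \<open>a b\<inverse>\<close> (in this order).
  The class \<^class>\<open>polish_space\<close> carries a compatible complete metric, but none of the notions
  below refers to it: they depend on the topology only.
\<close>

definition difference_op :: "'a::group_add \<Rightarrow> ('a \<Rightarrow> 'b::group_add) \<Rightarrow> 'a \<Rightarrow> 'b" where
  "difference_op g f = (\<lambda>x. f (g + x) - f x)"

text \<open>
  The list \<open>gs = [g\<^sub>0, \<dots>, g\<^sub>d]\<close> is processed from the left by \<^const>\<open>fold\<close>, so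
  \<open>fold difference_op gs P\<close> applies the operator of \<open>g\<^sub>0\<close> first.
\<close>

definition leibman_polynomial_deg_le :: "nat \<Rightarrow> ('a::group_add \<Rightarrow> 'b::group_add) \<Rightarrow> bool" where
  "leibman_polynomial_deg_le d P \<longleftrightarrow>
     (\<forall>gs x. length gs = Suc d \<longrightarrow> fold difference_op gs P x = 0)"

definition leibman_polynomial :: "('a::group_add \<Rightarrow> 'b::group_add) \<Rightarrow> bool" where
  "leibman_polynomial P \<longleftrightarrow> (\<exists>d. leibman_polynomial_deg_le d P)"

text \<open>
  Left Haar measures on a locally compact Polish group. Regularity is not listed, since on such
  a space every Borel measure that is finite on compact sets is regular. A left Haar measure is
  unique up to a positive factor and has the same null sets as a right Haar measure, so its
  completion has the same measurable sets whichever one is chosen.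
\<close>

definition haar_measure :: "'a::{topological_group_add, polish_space} measure \<Rightarrow> bool" where
  "haar_measure \<mu> \<longleftrightarrow>
     sets \<mu> = sets borel \<and>
     emeasure \<mu> UNIV \<noteq> 0 \<and>
     (\<forall>K. compact K \<longrightarrow> emeasure \<mu> K < \<infinity>) \<and>
     (\<forall>g. \<forall>A\<in>sets borel. emeasure \<mu> ((\<lambda>x. g + x) ` A) = emeasure \<mu> A)"

definition haar_measurable ::
  "'a::{topological_group_add, polish_space} measure \<Rightarrow> ('a \<Rightarrow> 'b::topological_space) \<Rightarrow> bool" where
  "haar_measurable \<mu> f \<longleftrightarrow> (\<forall>U. open U \<longrightarrow> f -` U \<in> sets (completion \<mu>))"

end

theory Submission
  imports Defs
begin

text \<open>By induction on the degree all differences of \<open>P\<close> are continuous, so it suffices that a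
  measurable \<open>P\<close> whose differences are all continuous is continuous, and for this that it is
  continuous at one point. That follows from Steinhaus' theorem.\<close>

section \<open>Preliminaries on topology, differences and measurability\<close>

text \<open>By the Lindelof property, countably many of the open sets that lie in some compact set
  already cover the space; each is then enlarged to a compact set. This serves sigma-finiteness and
  the existence of compact sets of positive measure.\<close>

lemma locally_compact_countable_compact_cover:
  assumes "locally_compact_space (euclidean :: 'a::second_countable_topology topology)"
  obtains \<C> :: "'a::second_countable_topology set set"
    where "countable \<C>" "\<And>K. K \<in> \<C> \<Longrightarrow> compact K" "\<Union>\<C> = UNIV"
proof -
  let ?\<F> = "{U :: 'a set. open U \<and> (\<exists>K. compact K \<and> U \<subseteq> K)}"
  have cover: "\<Union>?\<F> = UNIV"
    using assms by (fastforce simp: locally_compact_space_def)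
  obtain \<F>' where \<F>': "\<F>' \<subseteq> ?\<F>" "countable \<F>'" "\<Union>\<F>' = \<Union>?\<F>"
    by (rule Lindelof[of ?\<F>]) auto
  obtain c where c: "\<And>U. U \<in> \<F>' \<Longrightarrow> compact (c U) \<and> U \<subseteq> c U"
    using \<F>'(1) by (subgoal_tac "\<forall>U\<in>\<F>'. \<exists>K. compact K \<and> U \<subseteq> K") (metis, blast)
  show thesis
  proof
    show "countable (c ` \<F>')" using \<F>'(2) by simp
    have "\<Union>\<F>' \<subseteq> \<Union>(c ` \<F>')" using c by (intro Union_least) blast
    then show "\<Union>(c ` \<F>') = UNIV" unfolding \<F>'(3) cover by blast
  qed (use c in auto)
qed

text \<open>Without commutativity the order matters: a common term cancels when it is subtracted on
  the right. Approximating constants are therefore subtracted on the right below.\<close>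

lemma diff_diff_cancel_right: "(a - c) - (b - c) = a - (b::'a::group_add)"
  by (metis diff_add_eq_diff_diff_swap diff_eq_eq)

text \<open>A member of the cover that contains the limit contains \<open>f n\<close> for all but
  finitely many \<open>n\<close>. This will put infinitely many translates of a compact set into one
  compact set.\<close>

lemma compact_insert_limit_range:
  fixes f :: "nat \<Rightarrow> 'a::topological_space"
  assumes "f \<longlonglongrightarrow> l"
  shows "compact (insert l (range f))"
proof (rule compactI)
  fix \<T> :: "'a set set"
  assume op: "\<forall>T\<in>\<T>. open T" and sub: "insert l (range f) \<subseteq> \<Union>\<T>"
  then obtain U where U: "U \<in> \<T>" "l \<in> U" by blast
  then have "\<forall>\<^sub>F n in sequentially. f n \<in> U"
    using topological_tendstoD[OF assms, of U] op by blast
  then obtain n0 where n0: "\<And>n. n \<ge> n0 \<Longrightarrow> f n \<in> U" by (auto simp: eventually_sequentially)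
  have "\<forall>n. \<exists>T\<in>\<T>. f n \<in> T" using sub by blast
  then obtain c where c: "\<And>n. c n \<in> \<T> \<and> f n \<in> c n" by metis
  have "f n \<in> \<Union>(insert U (c ` {..<n0}))" for n
    using n0[of n] c[of n] by (cases "n < n0") auto
  then have "insert l (range f) \<subseteq> \<Union>(insert U (c ` {..<n0}))" using U by blast
  then show "\<exists>\<T>'\<subseteq>\<T>. finite \<T>' \<and> insert l (range f) \<subseteq> \<Union>\<T>'"
    using U c by (intro exI[of _ "insert U (c ` {..<n0})"]) blast
qed

lemma difference_op_deg_le:
  assumes "leibman_polynomial_deg_le (Suc d) P"
  shows "leibman_polynomial_deg_le d (difference_op g P)"
  unfolding leibman_polynomial_deg_le_def
proof (intro allI impI)
  fix gs :: "'a list" and x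
  assume "length gs = Suc d"
  then have "fold difference_op (g # gs) P x = 0"
    using assms unfolding leibman_polynomial_deg_le_def
    by (metis length_Cons)
  then show "fold difference_op gs (difference_op g P) x = 0" by simp
qed

lemma haar_measurable_iff:
  assumes "haar_measure \<mu>"
  shows "haar_measurable \<mu> f \<longleftrightarrow> f \<in> borel_measurable (completion \<mu>)"
proof -
  have "space \<mu> = UNIV"
    using assms unfolding haar_measure_def by (metis sets_eq_imp_space_eq space_borel)
  then show ?thesis
    unfolding haar_measurable_def
    using measurable_sets[of f "completion \<mu>" borel]
    by (intro iffI borel_measurableI) auto
qed

text \<open>Second countability makes the pair \<open>(f, g)\<close> measurable for the Borel sets
  of the product, so it can be composed with the continuous subtraction.\<close>

lemma borel_measurable_group_diff:
  fixes f g :: "'a \<Rightarrow> 'b::{second_countable_topology, topological_group_add}"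
  assumes "f \<in> borel_measurable M" "g \<in> borel_measurable M"
  shows "(\<lambda>x. f x - g x) \<in> borel_measurable M"
  using assms by (rule borel_measurable_continuous_Pair) (intro continuous_intros)

section \<open>Haar measure and its null sets\<close>

locale haar =
  fixes \<mu> :: "'g::{topological_group_add, polish_space} measure"
  assumes locally_compact: "locally_compact_space (euclidean :: 'g topology)"
    and haar_measure: "haar_measure \<mu>"
begin

lemma sets_\<mu> [simp, measurable_cong]: "sets \<mu> = sets borel"
  using haar_measure by (simp add: haar_measure_def)

lemma space_\<mu> [simp]: "space \<mu> = UNIV"
  using sets_eq_imp_space_eq[OF sets_\<mu>] by simp

lemma emeasure_compact: "compact K \<Longrightarrow> emeasure \<mu> K < \<infinity>"
  using haar_measure by (simp add: haar_measure_def)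

lemma emeasure_left_translation:
  "A \<in> sets borel \<Longrightarrow> emeasure \<mu> ((\<lambda>x. g + x) ` A) = emeasure \<mu> A"
  using haar_measure by (simp add: haar_measure_def)

lemma emeasure_left_translation_vimage:
  assumes "A \<in> sets borel"
  shows "emeasure \<mu> ((\<lambda>x. g + x) -` A) = emeasure \<mu> A"
proof -
  have "(\<lambda>x. g + x) -` A = (\<lambda>x. - g + x) ` A"
    by (force simp: image_iff add.assoc[symmetric] intro: rev_image_eqI)
  then show ?thesis using emeasure_left_translation[OF assms] by simp
qed

sublocale sigma_finite_measure \<mu>
proof
  obtain \<C> :: "'g set set" where "countable \<C>" "\<And>K. K \<in> \<C> \<Longrightarrow> compact K" "\<Union>\<C> = UNIV"
    using locally_compact_countable_compact_cover[OF locally_compact] by blast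
  moreover from this have "\<C> \<subseteq> sets \<mu>" "\<forall>K\<in>\<C>. emeasure \<mu> K \<noteq> \<infinity>"
    using emeasure_compact by (auto simp: borel_compact less_top)
  ultimately show
    "\<exists>A. countable A \<and> A \<subseteq> sets \<mu> \<and> \<Union>A = space \<mu> \<and> (\<forall>a\<in>A. emeasure \<mu> a \<noteq> \<infinity>)"
    by (intro exI[of _ \<C>]) simp
qed

text \<open>The set of pairs with \<open>- x + y \<in> N\<close> is measured in two ways. Its slices
  at fixed \<open>x\<close> are left translates of \<open>N\<close>, hence null; its slices at fixed
  \<open>y\<close> are left translates of the inverse of \<open>N\<close>. So the measure of that
  inverse times the nonzero measure of the group is 0.\<close>

lemma null_sets_uminus:
  assumes N: "N \<in> null_sets \<mu>"
  shows "uminus -` N \<in> null_sets \<mu>"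
proof -
  have [measurable]: "N \<in> sets borel" using N by auto
  have um: "(uminus :: 'g \<Rightarrow> 'g) \<in> borel_measurable borel"
    by (intro borel_measurable_continuous_onI continuous_intros)
  then have um_sets: "uminus -` N \<in> sets borel"
    using measurable_sets[OF um \<open>N \<in> sets borel\<close>] by simp
  have "(\<lambda>z::'g \<times> 'g. - fst z + snd z) \<in> borel_measurable borel"
    by (intro borel_measurable_continuous_onI continuous_intros)
  then have m: "(\<lambda>z. - fst z + snd z) \<in> borel_measurable (\<mu> \<Otimes>\<^sub>M \<mu>)"
    using sets_pair_measure_cong[OF sets_\<mu> sets_\<mu>] unfolding borel_prod
    by (subst measurable_cong_sets[OF _ refl])
  let ?S = "(\<lambda>z. - fst z + snd z) -` N"
  have S: "?S \<in> sets (\<mu> \<Otimes>\<^sub>M \<mu>)"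
    using measurable_sets[OF m \<open>N \<in> sets borel\<close>] by (simp add: space_pair_measure)
  have 1: "emeasure \<mu> (Pair x -` ?S) = 0" for x
  proof -
    have "Pair x -` ?S = (\<lambda>y. - x + y) -` N" by auto
    then show ?thesis using emeasure_left_translation_vimage[of N "- x"] N by auto
  qed
  have 2: "emeasure \<mu> ((\<lambda>x. (x, y)) -` ?S) = emeasure \<mu> (uminus -` N)" for y
  proof -
    have "(\<lambda>x. (x, y)) -` ?S = (\<lambda>x. - y + x) -` uminus -` N" by (auto simp: minus_add)
    then show ?thesis using emeasure_left_translation_vimage[OF um_sets, of "- y"] by simp
  qed
  have "emeasure (\<mu> \<Otimes>\<^sub>M \<mu>) ?S = 0"
    using emeasure_pair_measure_alt[OF S] 1 by simp
  moreover have "pair_sigma_finite \<mu> \<mu>" ..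
  ultimately have "emeasure \<mu> (uminus -` N) * emeasure \<mu> UNIV = 0"
    using pair_sigma_finite.emeasure_pair_measure_alt2[OF _ S] 2 by simp
  then show ?thesis
    using haar_measure um_sets by (auto simp: haar_measure_def)
qed

lemma null_sets_left_translation:
  assumes "N \<in> null_sets \<mu>"
  shows "(\<lambda>x. g + x) -` N \<in> null_sets \<mu>"
proof -
  have N: "N \<in> sets borel" using assms by auto
  have "(\<lambda>x. g + x) \<in> borel_measurable borel"
    by (intro borel_measurable_continuous_onI continuous_intros)
  from measurable_sets[OF this N] have "(\<lambda>x. g + x) -` N \<in> sets \<mu>" by simp
  moreover have "emeasure \<mu> ((\<lambda>x. g + x) -` N) = 0"
    using emeasure_left_translation_vimage[OF N] assms by (simp add: null_setsD1)
  ultimately show ?thesis by blast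
qed

text \<open>A right translation is a left translation conjugated by inversion. Only null sets are
  considered, since right translations may rescale a left Haar measure.\<close>

lemma null_sets_right_translation:
  assumes "N \<in> null_sets \<mu>"
  shows "(\<lambda>x. x + g) -` N \<in> null_sets \<mu>"
proof -
  have "(\<lambda>x. x + g) -` N = uminus -` (\<lambda>x. - g + x) -` uminus -` N"
    by (auto simp: minus_add)
  then show ?thesis
    using assms by (simp add: null_sets_uminus null_sets_left_translation)
qed

section \<open>Haar measurability of translates and differences\<close>

text \<open>The completion adds subsets of Borel null sets. Their preimages stay measurable because
  \<open>T\<close> pulls null sets back to null sets.\<close>

lemma measurable_completion_map:
  assumes c: "continuous_on UNIV T"
    and null: "\<And>N. N \<in> null_sets \<mu> \<Longrightarrow> T -` N \<in> null_sets \<mu>"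
  shows "T \<in> completion \<mu> \<rightarrow>\<^sub>M completion \<mu>"
proof -
  have "T \<in> \<mu> \<rightarrow>\<^sub>M \<mu>"
    using borel_measurable_continuous_onI[OF c] by (simp add: measurable_cong_sets[OF sets_\<mu> sets_\<mu>])
  then have T: "T \<in> completion \<mu> \<rightarrow>\<^sub>M \<mu>" by (rule measurable_completion)
  show ?thesis
  proof (rule completion.measurable_completion2[OF T], rule subsetI)
    fix N assume N: "N \<in> null_sets \<mu>"
    then have "T -` N \<in> null_sets (completion \<mu>)" using null null_sets_completionI by blast
    then show "N \<in> null_sets (distr (completion \<mu>) \<mu> T)"
      using N T by (auto simp: null_sets_def emeasure_distr)
  qed
qed

lemma haar_measurable_left_translation:
  assumes "haar_measurable \<mu> f"
  shows "haar_measurable \<mu> (\<lambda>x. f (g + x))"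
proof -
  have "(\<lambda>x. g + x) \<in> completion \<mu> \<rightarrow>\<^sub>M completion \<mu>"
    by (rule measurable_completion_map) (auto intro!: continuous_intros null_sets_left_translation)
  then show ?thesis
    using assms unfolding haar_measurable_iff[OF haar_measure] by (rule measurable_compose)
qed

text \<open>Needed because \<open>P (g + y)\<close>, as a function of \<open>g\<close> with
  \<open>y\<close> fixed, is a right translate of \<open>P\<close>.\<close>

lemma haar_measurable_right_translation:
  assumes "haar_measurable \<mu> f"
  shows "haar_measurable \<mu> (\<lambda>x. f (x + g))"
proof -
  have "(\<lambda>x. x + g) \<in> completion \<mu> \<rightarrow>\<^sub>M completion \<mu>"
    by (rule measurable_completion_map) (auto intro!: continuous_intros null_sets_right_translation)
  then show ?thesis
    using assms unfolding haar_measurable_iff[OF haar_measure] by (rule measurable_compose)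
qed

lemma haar_measurable_difference_op:
  fixes f :: "'g \<Rightarrow> 'h::{topological_group_add, second_countable_topology}"
  assumes "haar_measurable \<mu> f"
  shows "haar_measurable \<mu> (difference_op g f)"
  using assms haar_measurable_left_translation[OF assms, of g]
  unfolding haar_measurable_iff[OF haar_measure] difference_op_def
  by (intro borel_measurable_group_diff)

section \<open>Compact sets of positive measure and Steinhaus' theorem\<close>

text \<open>Otherwise a countable cover by compact null sets would make the whole group
  null.\<close>

lemma exists_compact_positive_measure:
  obtains C where "compact C" "emeasure \<mu> C > 0"
proof -
  obtain \<C> :: "'g set set"
    where \<C>: "countable \<C>" "\<And>K. K \<in> \<C> \<Longrightarrow> compact K" "\<Union>\<C> = UNIV"
    using locally_compact_countable_compact_cover[OF locally_compact] by blast
  have "\<exists>C\<in>\<C>. emeasure \<mu> C \<noteq> 0"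
  proof (rule ccontr)
    assume "\<not> ?thesis"
    then have "\<And>C. C \<in> \<C> \<Longrightarrow> C \<in> null_sets \<mu>"
      using \<C>(2) by (auto simp: null_sets_def borel_compact)
    then have "(\<Union>C\<in>\<C>. C) \<in> null_sets \<mu>" by (rule null_sets_UN'[OF \<C>(1)])
    then show False using \<C>(3) haar_measure by (auto simp: haar_measure_def)
  qed
  then show thesis using that \<C>(2) by (meson zero_less_iff_neq_zero)
qed

text \<open>Inner regularity is applied to a finite Borel measure: \<open>B\<close> is replaced by
  its Borel main part, which carries the same measure, and \<open>\<mu>\<close> by its restriction
  to \<open>C\<close>.\<close>

lemma exists_compact_subset_positive_measure:
  assumes B: "B \<in> sets (completion \<mu>)" "B \<subseteq> C" and C: "compact C"
    and pos: "emeasure (completion \<mu>) B > 0"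
  obtains K where "compact K" "K \<subseteq> B" "emeasure \<mu> K > 0"
proof -
  let ?A = "main_part \<mu> B"
  have A: "?A \<in> sets borel" "?A \<subseteq> B"
    using main_part_sets[OF B(1)] main_part_null_part_Un[OF B(1)] by auto
  have C_sets: "C \<in> sets borel" using C by (simp add: borel_compact)
  define M where "M = density \<mu> (indicator C)"
  have M: "emeasure M E = emeasure \<mu> (C \<inter> E)" if "E \<in> sets borel" for E
    unfolding M_def using that C_sets
    by (simp add: emeasure_density indicator_inter_arith[symmetric])
  have "emeasure M (space M) \<noteq> \<infinity>"
    using M[of UNIV] emeasure_compact[OF C] by (simp add: M_def)
  then have "emeasure M ?A = (SUP K \<in> {K. K \<subseteq> ?A \<and> compact K}. emeasure M K)"
    using A by (intro inner_regular) (auto simp: M_def)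
  moreover have "emeasure M ?A > 0"
    using pos M[OF A(1)] A(2) B by (simp add: Int_absorb1)
  ultimately obtain K where K: "K \<subseteq> ?A" "compact K" "emeasure M K > 0"
    by (auto simp: less_SUP_iff)
  then have "emeasure \<mu> K > 0"
    using M[of K] A(2) B(2) by (simp add: borel_compact Int_absorb1)
  then show thesis using that K A(2) by blast
qed

text \<open>The sets \<open>(\<Union>m\<ge>n. h\<^sub>m + K) - K\<close> decrease to the empty set, so their measures tend to 0,
  while one of them would contain \<open>h\<^sub>n + K\<close> if that set missed \<open>K\<close>.\<close>

lemma steinhaus:
  assumes K: "compact K" and pos: "emeasure \<mu> K > 0"
  shows "\<forall>\<^sub>F h in nhds 0. (\<lambda>x. h + x) ` K \<inter> K \<noteq> {}"
  unfolding eventually_nhds_iff_sequentially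
proof (intro allI impI)
  fix h :: "nat \<Rightarrow> 'g"
  assume h: "h \<longlonglongrightarrow> 0"
  have translate: "compact ((\<lambda>x. g + x) ` K)" for g
    using K by (intro compact_continuous_image continuous_intros)
  define D where "D n = (\<Union>m\<in>{n..}. (\<lambda>x. h m + x) ` K) - K" for n
  have D_sets: "D n \<in> sets \<mu>" for n
    unfolding D_def using K translate
    by (intro sets.Diff sets.countable_UN') (auto simp: borel_compact)
  have D_dec: "decseq D" unfolding D_def decseq_def by fastforce
  \<comment> \<open>One compact set containing every \<open>D n\<close>; its finite measure permits
    continuity from above.\<close>
  define L where "L = (\<lambda>z. fst z + snd z) ` (insert 0 (range h) \<times> K)"
  have L: "compact L"
    unfolding L_def using K compact_insert_limit_range[OF h]
    by (intro compact_continuous_image compact_Times continuous_intros)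
  have "D n \<subseteq> L" for n unfolding D_def L_def by force
  then have "emeasure \<mu> (D n) \<le> emeasure \<mu> L" for n
    using L by (intro emeasure_mono) (auto simp: borel_compact)
  then have fin: "emeasure \<mu> (D n) \<noteq> \<infinity>" for n
    using emeasure_compact[OF L] by (metis infinity_ennreal_def leD)
  have "(\<Inter>n. D n) = {}"
  proof (rule equals0I)
    \<comment> \<open>A point outside the closed set \<open>K\<close> also has
      \<open>- h n + x\<close> outside \<open>K\<close> for large \<open>n\<close>, so it lies in
      only finitely many of the translates.\<close>
    fix x assume x: "x \<in> (\<Inter>n. D n)"
    then have "x \<in> - K" unfolding D_def by auto
    moreover have "(\<lambda>n. - h n + x) \<longlonglongrightarrow> - 0 + x" by (intro tendsto_intros h)
    ultimately have "\<forall>\<^sub>F n in sequentially. - h n + x \<in> - K"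
      using compact_imp_closed[OF K] by (intro topological_tendstoD) auto
    then obtain n where n: "\<And>m. m \<ge> n \<Longrightarrow> - h m + x \<notin> K"
      by (auto simp: eventually_sequentially)
    have "x \<in> D n" using x by blast
    then obtain m y where "m \<ge> n" "y \<in> K" "x = h m + y" unfolding D_def by auto
    then show False using n[of m] by (simp add: add.assoc[symmetric])
  qed
  then have "(\<lambda>n. emeasure \<mu> (D n)) \<longlonglongrightarrow> 0"
    using Lim_emeasure_decseq[of D \<mu>] D_sets D_dec fin by (simp add: image_subset_iff)
  then have "\<forall>\<^sub>F n in sequentially. emeasure \<mu> (D n) < emeasure \<mu> K"
    using pos by (rule order_tendstoD)
  then show "\<forall>\<^sub>F n in sequentially. (\<lambda>x. h n + x) ` K \<inter> K \<noteq> {}"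
  proof eventually_elim
    case (elim n)
    show ?case
    proof
      assume "(\<lambda>x. h n + x) ` K \<inter> K = {}"
      then have "(\<lambda>x. h n + x) ` K \<subseteq> D n" unfolding D_def by auto
      then have "emeasure \<mu> ((\<lambda>x. h n + x) ` K) \<le> emeasure \<mu> (D n)"
        using D_sets by (rule emeasure_mono)
      then show False
        using elim emeasure_left_translation[of K "h n"] K by (simp add: borel_compact)
    qed
  qed
qed

section \<open>Continuity at the identity\<close>

text \<open>Here \<open>\<Phi>(g, y) = P (g + y) - P y\<close> is measurable in \<open>g\<close> and continuous in \<open>y\<close>. By separability
  there is a set \<open>B\<close> of positive measure whose elements \<open>g\<close> have nearly the same function
  \<open>\<Phi>(g, \<cdot>)\<close> on a compact set. If \<open>h\<close> is small, then \<open>h + g = g'\<close> for some \<open>g, g' \<in> B\<close>, and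
  \<open>P h - P 0 = \<Phi>(g', y) - \<Phi>(g, y)\<close> with \<open>y = - g\<close>.\<close>

lemma tendsto_at_zero_if_differences_continuous:
  fixes P :: "'g \<Rightarrow> 'h::{topological_group_add, polish_space}"
  assumes meas: "haar_measurable \<mu> P"
    and cont: "\<And>g. continuous_on UNIV (difference_op g P)"
  shows "(P \<longlongrightarrow> P 0) (nhds 0)"
proof (rule topological_tendstoI)
  fix V :: "'h set"
  assume V: "open V" "P 0 \<in> V"
  define \<Phi> where "\<Phi> g = difference_op g P" for g
  have \<Phi>_cont: "continuous_on UNIV (\<Phi> g)" for g using cont unfolding \<Phi>_def .
  have "open ((\<lambda>v. v + P 0) -` V)"
    using V by (intro open_vimage continuous_intros)
  \<comment> \<open>The ball is closed because closeness will first be known on a dense set and must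
    pass to limits.\<close>
  then obtain e where e: "e > 0" "cball 0 e \<subseteq> (\<lambda>v. v + P 0) -` V"
    using V by (force simp: open_contains_cball)
  \<comment> \<open>The metric need not be invariant, so continuity of subtraction at
    \<open>(0, 0)\<close> takes the place of the triangle inequality.\<close>
  have "open ((\<lambda>z::'h \<times> 'h. fst z - snd z) -` ball 0 e)"
    by (intro open_vimage continuous_intros) auto
  moreover have "(0, 0) \<in> (\<lambda>z::'h \<times> 'h. fst z - snd z) -` ball 0 e" using e by simp
  ultimately obtain W1 W2 where W12: "open W1" "open W2" "(0, 0) \<in> W1 \<times> W2"
    "W1 \<times> W2 \<subseteq> (\<lambda>z::'h \<times> 'h. fst z - snd z) -` ball 0 e"
    by (rule open_prod_elim)
  define W where "W = W1 \<inter> W2"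
  have W: "open W" "0 \<in> W" and W_diff: "\<And>a b. a \<in> W \<Longrightarrow> b \<in> W \<Longrightarrow> a - b \<in> ball 0 e"
    using W12 unfolding W_def by (auto simp: subset_iff)
  \<comment> \<open>\<open>D\<close> will reduce the conditions on \<open>g\<close> to countably
    many; \<open>D'\<close> and the basis \<open>\<B>\<close> keep the family of approximations
    countable.\<close>
  obtain D :: "'g set"
    where D: "countable D" "\<And>U. open U \<Longrightarrow> U \<noteq> {} \<Longrightarrow> \<exists>d\<in>D. d \<in> U"
    by (rule countable_dense_setE) blast
  obtain D' :: "'h set"
    where D': "countable D'" "\<And>U. open U \<Longrightarrow> U \<noteq> {} \<Longrightarrow> \<exists>d\<in>D'. d \<in> U"
    by (rule countable_dense_setE) blast
  obtain \<B> :: "'g set set" where \<B>: "countable \<B>" "topological_basis \<B>"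
    using ex_countable_basis by blast
  obtain C where C: "compact C" "emeasure \<mu> C > 0"
    using exists_compact_positive_measure by blast
  \<comment> \<open>The functions \<open>\<Phi> g\<close> with \<open>g \<in> C\<close> will be
    evaluated at \<open>- g\<close>, so they are compared on the inverse of
    \<open>C\<close>.\<close>
  have mC: "compact (uminus ` C)"
    using C by (intro compact_continuous_image continuous_intros)
  \<comment> \<open>Each \<open>S\<close> encodes a rough approximation to a function on the inverse
    of \<open>C\<close>: near the value \<open>c\<close> on \<open>U\<close>, for each pair
    \<open>(U, c)\<close>.\<close>
  define \<S> where "\<S> = {S. finite S \<and> S \<subseteq> \<B> \<times> D' \<and> uminus ` C \<subseteq> (\<Union>(U, c)\<in>S. U)}"
  have "countable \<S>"
    using countable_Collect_finite_subset[of "\<B> \<times> D'"] \<B>(1) D'(1)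
    by (rule_tac countable_subset[of _ "{S. finite S \<and> S \<subseteq> \<B> \<times> D'}"]) (auto simp: \<S>_def)
  \<comment> \<open>Testing only \<open>y\<close> in \<open>D\<close> makes \<open>B S\<close> a
    countable intersection, hence measurable.\<close>
  define B where "B S = {g \<in> C. \<forall>(U, c)\<in>S. \<forall>y\<in>U \<inter> D. \<Phi> g y - c \<in> W}" for S
  \<comment> \<open>Density of \<open>D'\<close> and continuity of \<open>\<Phi> g\<close> give each
    point a basic open set and a constant; compactness leaves finitely many such pairs.\<close>
  have cover: "\<exists>S\<in>\<S>. g \<in> B S" if g: "g \<in> C" for g
  proof -
    define \<T> where "\<T> = {(U, c) \<in> \<B> \<times> D'. \<forall>y\<in>U. \<Phi> g y - c \<in> W}"
    have "\<exists>t\<in>\<T>. y \<in> fst t" for y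
    proof -
      have "open ((\<lambda>c. \<Phi> g y - c) -` W)" using W by (intro open_vimage continuous_intros)
      moreover have "\<Phi> g y \<in> (\<lambda>c. \<Phi> g y - c) -` W" using W by simp
      ultimately obtain c where c: "c \<in> D'" "\<Phi> g y - c \<in> W" using D'(2) by (metis empty_iff vimage_eq)
      have "open ((\<lambda>y. \<Phi> g y - c) -` W)"
        using W \<Phi>_cont by (intro open_vimage continuous_intros)
      then obtain U where "U \<in> \<B>" "y \<in> U" "U \<subseteq> (\<lambda>y. \<Phi> g y - c) -` W"
        using topological_basisE[OF \<B>(2)] c(2) by (metis vimageI2)
      then show ?thesis using c by (intro bexI[of _ "(U, c)"]) (auto simp: \<T>_def)
    qed
    then have "uminus ` C \<subseteq> (\<Union>t\<in>\<T>. fst t)" by blast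
    moreover have "\<And>t. t \<in> \<T> \<Longrightarrow> open (fst t)"
      using topological_basis_open[OF \<B>(2)] by (auto simp: \<T>_def)
    ultimately obtain S where S: "S \<subseteq> \<T>" "finite S" "uminus ` C \<subseteq> (\<Union>t\<in>S. fst t)"
      using compactE_image[OF mC, of \<T> fst] by metis
    then have "S \<in> \<S>" unfolding \<S>_def \<T>_def by fastforce
    moreover have "g \<in> B S" using S(1) g unfolding B_def \<T>_def by blast
    ultimately show ?thesis by blast
  qed
  have B_sets: "B S \<in> sets (completion \<mu>)" if "S \<in> \<S>" for S
  proof -
    have vimage: "{g. \<Phi> g y - c \<in> W} \<in> sets (completion \<mu>)" for y c
    proof -
      have "open ((\<lambda>v. v - P y - c) -` W)" using W by (intro open_vimage continuous_intros)
      then have "(\<lambda>g. P (g + y)) -` ((\<lambda>v. v - P y - c) -` W) \<in> sets (completion \<mu>)"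
        using haar_measurable_right_translation[OF meas] unfolding haar_measurable_def by blast
      then show ?thesis by (simp add: \<Phi>_def difference_op_def vimage_def)
    qed
    have UNIV_sets: "UNIV \<in> sets (completion \<mu>)"
      using sets.top[of "completion \<mu>"] by simp
    have "countable S" using that by (auto simp: \<S>_def countable_finite)
    then have "(\<Inter>t\<in>S. \<Inter>y\<in>fst t \<inter> D. {g. \<Phi> g y - snd t \<in> W}) \<in> sets (completion \<mu>)"
      using D(1) vimage UNIV_sets by (intro sets.countable_INT'') auto
    then have "C \<inter> (\<Inter>t\<in>S. \<Inter>y\<in>fst t \<inter> D. {g. \<Phi> g y - snd t \<in> W}) \<in> sets (completion \<mu>)"
      using C(1) by (intro sets.Int) (simp_all add: borel_compact)
    also have "C \<inter> (\<Inter>t\<in>S. \<Inter>y\<in>fst t \<inter> D. {g. \<Phi> g y - snd t \<in> W}) = B S"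
      unfolding B_def by fastforce
    finally show ?thesis .
  qed
  \<comment> \<open>Countably many sets \<open>B S\<close> cover \<open>C\<close>, which has
    positive measure, so they cannot all be null.\<close>
  have "\<exists>S\<in>\<S>. emeasure (completion \<mu>) (B S) \<noteq> 0"
  proof (rule ccontr)
    assume "\<not> ?thesis"
    then have "(\<Union>S\<in>\<S>. B S) \<in> null_sets (completion \<mu>)"
      using B_sets by (intro null_sets_UN' \<open>countable \<S>\<close>) (auto simp: null_sets_def)
    moreover have "(\<Union>S\<in>\<S>. B S) = C" using cover by (auto simp: B_def)
    ultimately show False using C by (auto simp: null_sets_completion_iff borel_compact)
  qed
  then obtain S where S: "S \<in> \<S>" "emeasure (completion \<mu>) (B S) > 0"
    by (auto simp: zero_less_iff_neq_zero)
  \<comment> \<open>If the values were far apart at \<open>y\<close>, continuity would keep them far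
    apart on an open part of \<open>U\<close>. That part meets \<open>D\<close>, where both values
    are close to the same \<open>c\<close>.\<close>
  have B_close: "\<Phi> g' y - \<Phi> g y \<in> cball 0 e"
    if g: "g \<in> B S" "g' \<in> B S" and y: "y \<in> uminus ` C" for g g' y
  proof (rule ccontr)
    assume far: "\<Phi> g' y - \<Phi> g y \<notin> cball 0 e"
    obtain U c where U: "(U, c) \<in> S" "y \<in> U" using S(1) y unfolding \<S>_def by blast
    then have "open U" using S(1) topological_basis_open[OF \<B>(2)] unfolding \<S>_def by blast
    moreover have "open ((\<lambda>y. \<Phi> g' y - \<Phi> g y) -` (- cball 0 e))"
      using \<Phi>_cont by (intro open_vimage continuous_intros) auto
    ultimately have "open (U \<inter> (\<lambda>y. \<Phi> g' y - \<Phi> g y) -` (- cball 0 e))" by (rule open_Int)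
    moreover have "y \<in> U \<inter> (\<lambda>y. \<Phi> g' y - \<Phi> g y) -` (- cball 0 e)" using U far by simp
    ultimately obtain y' where y': "y' \<in> D" "y' \<in> U" "\<Phi> g' y' - \<Phi> g y' \<notin> cball 0 e"
      using D(2)[of "U \<inter> (\<lambda>y. \<Phi> g' y - \<Phi> g y) -` (- cball 0 e)"] by blast
    then have "(\<Phi> g' y' - c) - (\<Phi> g y' - c) \<in> ball 0 e"
      using g U(1) unfolding B_def by (intro W_diff) blast+
    moreover have "(\<Phi> g' y' - c) - (\<Phi> g y' - c) = \<Phi> g' y' - \<Phi> g y'"
      by (rule diff_diff_cancel_right)
    ultimately show False using y'(3) by simp
  qed
  obtain K where K: "compact K" "K \<subseteq> B S" "emeasure \<mu> K > 0"
    using exists_compact_subset_positive_measure[OF B_sets[OF S(1)] _ C(1) S(2)]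
    unfolding B_def by blast
  from steinhaus[OF K(1,3)] show "\<forall>\<^sub>F h in nhds 0. P h \<in> V"
  proof eventually_elim
    case (elim h)
    then obtain g where g: "g \<in> K" "h + g \<in> K" by blast
    then have "- g \<in> uminus ` C" using K(2) unfolding B_def by blast
    then have "\<Phi> (h + g) (- g) - \<Phi> g (- g) \<in> cball 0 e" using B_close g K(2) by blast
    moreover have "\<Phi> (h + g) (- g) - \<Phi> g (- g) = P h - P 0"
      by (simp add: \<Phi>_def difference_op_def add.assoc diff_diff_cancel_right)
    ultimately have "P h - P 0 \<in> (\<lambda>v. v + P 0) -` V" using e(2) by auto
    then show "P h \<in> V" by simp
  qed
qed

section \<open>Continuity everywhere and induction on the degree\<close>

text \<open>Continuity at 0 is carried to \<open>a\<close> by the identity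
  \<open>P x = difference_op a P (- a + x) + P (- a + x)\<close>, whose first summand is continuous
  by assumption.\<close>

lemma continuous_if_differences_continuous:
  fixes P :: "'g \<Rightarrow> 'h::{topological_group_add, polish_space}"
  assumes "haar_measurable \<mu> P" and cont: "\<And>g. continuous_on UNIV (difference_op g P)"
  shows "continuous_on UNIV P"
proof -
  have "isCont P a" for a
  proof -
    have P0: "isCont P (- a + a)"
      using tendsto_at_zero_if_differences_continuous[OF assms]
      by (simp add: continuous_at tendsto_at_iff_tendsto_nhds)
    have shift: "isCont (\<lambda>x. - a + x) a"
      by (intro continuous_intros)
    have "isCont (difference_op a P) (- a + a)"
      using cont by (simp add: continuous_on_eq_continuous_at)
    from isCont_o2[OF shift this] isCont_o2[OF shift P0]
    have "isCont (\<lambda>x. difference_op a P (- a + x) + P (- a + x)) a"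
      by (rule continuous_add)
    then show ?thesis by (simp add: difference_op_def add.assoc[symmetric])
  qed
  then show ?thesis by (simp add: continuous_on_eq_continuous_at)
qed

text \<open>In degree 0 the difference by \<open>x\<close> at the point 0 shows
  \<open>P x = P 0\<close>. In the inductive step every difference is measurable and of lower
  degree, so \<open>P\<close> must be arbitrary in the induction.\<close>

lemma leibman_polynomial_deg_le_continuous:
  fixes P :: "'g \<Rightarrow> 'h::{topological_group_add, polish_space}"
  assumes "leibman_polynomial_deg_le d P" "haar_measurable \<mu> P"
  shows "continuous_on UNIV P"
  using assms
proof (induction d arbitrary: P)
  case 0
  have "P x = P 0" for x
  proof -
    have "fold difference_op [x] P 0 = 0"
      using 0(1) unfolding leibman_polynomial_deg_le_def by (metis length_Cons list.size(3))
    then show ?thesis by (simp add: difference_op_def)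
  qed
  then have "P = (\<lambda>x. P 0)" by blast
  then show ?case by (metis continuous_on_const)
next
  case (Suc d)
  then show ?case
    by (blast intro: continuous_if_differences_continuous difference_op_deg_le
        haar_measurable_difference_op)
qed

end

theorem theorem1p4:
  fixes P :: "'g::{topological_group_add, polish_space} \<Rightarrow> 'h::{topological_group_add, polish_space}"
    and \<mu> :: "'g measure"
  assumes "locally_compact_space (euclidean :: 'g topology)"
    and "locally_compact_space (euclidean :: 'h topology)"
    and "haar_measure \<mu>"
    and "haar_measurable \<mu> P"
    and "leibman_polynomial P"
  shows "continuous_on UNIV P"
proof -
  interpret haar \<mu> by unfold_locales (rule assms)+
  show ?thesis
    using assms(4,5) leibman_polynomial_deg_le_continuous unfolding leibman_polynomial_def by blast
qed

end
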